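(* If $t\ge 5$, then no complete $t$-partite graph $G$ admits a semi-regular drawing. Thus $\mathrm{tcr}(G)=\infty$.
   Context: A complete $t$-partite graph $K_{n_1,\dots,n_t}$ ($n_i\ge 1$) has vertex set partitioned into $t$ nonempty parts of sizes $n_1,\dots,n_t$, two vertices being adjacent iff they lie in different parts. A drawing of a graph represents it in the plane with vertices as distinct points and edges as simple arcs joining their end-vertices, subject to: the interior of an edge contains no vertex; two edges sharing an end-vertex do not intersect (apart from that vertex); two edges with no common end-vertex intersect at most once, and if so, transversally. A drawing is semi-regular if every crossing point is a triple crossing point (exactly three edges cross there). The triple crossing number $\mathrm{tcr}(G)$ is $0$ if $G$ is planar, $\infty$ if $G$ is non-planar and admits no semi-regular drawing, and otherwise the minimum number of triple crossing points over all semi-regular drawings of $G$. *)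

theory Defs
  imports
    "HOL-Analysis.Analysis"
    "HOL-Library.Disjoint_Sets"
    "HOL-Library.Extended_Nat"
begin

text \<open>A finite simple graph is given by its vertex set \<open>V\<close> and its set \<open>E\<close> of edges, an edge being
  the two-element set of its end-vertices. The plane is the type \<open>complex\<close>.\<close>

definition complete_multipartite :: "nat \<Rightarrow> 'a set \<Rightarrow> 'a set set \<Rightarrow> bool" where
  "complete_multipartite t V E \<longleftrightarrow>
     finite V \<and>
     (\<exists>P. partition_on V P \<and> card P = t \<and>
          E = {{u, v} | u v. u \<in> V \<and> v \<in> V \<and> \<not> (\<exists>X\<in>P. u \<in> X \<and> v \<in> X)})"

text \<open>Arcs are only assumed continuous, so transversality is the topological notion: near \<open>p\<close> some
  chart of the plane carries \<open>A\<close> and \<open>B\<close> to the two coordinate axes. This covers smooth and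
  polygonal arcs that cross at \<open>p\<close>.\<close>

definition transversal_at :: "complex set \<Rightarrow> complex set \<Rightarrow> complex \<Rightarrow> bool" where
  "transversal_at A B p \<longleftrightarrow>
     (\<exists>U h k. open U \<and> p \<in> U \<and> homeomorphism U (ball 0 1) h k \<and> h p = 0 \<and>
        h ` (A \<inter> U) = {z \<in> ball 0 1. Im z = 0} \<and>
        h ` (B \<inter> U) = {z \<in> ball 0 1. Re z = 0})"

text \<open>The vertex \<open>v\<close> is drawn at \<open>pos v\<close>, and the edge \<open>e\<close> as the image of the arc \<open>\<gamma> e\<close>, whose
  direction is immaterial.\<close>

locale drawing =
  fixes V :: "'a set" and E :: "'a set set"
    and pos :: "'a \<Rightarrow> complex" and \<gamma> :: "'a set \<Rightarrow> real \<Rightarrow> complex"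
  assumes inj_pos: "inj_on pos V"
    and arc_edge: "e \<in> E \<Longrightarrow> arc (\<gamma> e)"
    and ends_edge: "e \<in> E \<Longrightarrow> {pathstart (\<gamma> e), pathfinish (\<gamma> e)} = pos ` e"
    and interior_edge: "e \<in> E \<Longrightarrow> (path_image (\<gamma> e) - pos ` e) \<inter> pos ` V = {}"
    and adjacent_edges:
      "\<lbrakk>e \<in> E; f \<in> E; e \<noteq> f; e \<inter> f \<noteq> {}\<rbrakk> \<Longrightarrow>
         path_image (\<gamma> e) \<inter> path_image (\<gamma> f) = pos ` (e \<inter> f)"
    and disjoint_edges_once:
      "\<lbrakk>e \<in> E; f \<in> E; e \<inter> f = {};
        p \<in> path_image (\<gamma> e) \<inter> path_image (\<gamma> f);
        q \<in> path_image (\<gamma> e) \<inter> path_image (\<gamma> f)\<rbrakk> \<Longrightarrow> p = q"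
    and disjoint_edges_transversal:
      "\<lbrakk>e \<in> E; f \<in> E; e \<inter> f = {};
        p \<in> path_image (\<gamma> e) \<inter> path_image (\<gamma> f)\<rbrakk> \<Longrightarrow>
         transversal_at (path_image (\<gamma> e)) (path_image (\<gamma> f)) p"

definition crossing_points :: "'a set set \<Rightarrow> ('a set \<Rightarrow> real \<Rightarrow> complex) \<Rightarrow> complex set" where
  "crossing_points E \<gamma> =
     {p. \<exists>e\<in>E. \<exists>f\<in>E. e \<inter> f = {} \<and> p \<in> path_image (\<gamma> e) \<and> p \<in> path_image (\<gamma> f)}"

definition semi_regular_drawing ::
  "'a set \<Rightarrow> 'a set set \<Rightarrow> ('a \<Rightarrow> complex) \<Rightarrow> ('a set \<Rightarrow> real \<Rightarrow> complex) \<Rightarrow> bool" where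
  "semi_regular_drawing V E pos \<gamma> \<longleftrightarrow>
     drawing V E pos \<gamma> \<and>
     (\<forall>p\<in>crossing_points E \<gamma>. card {e \<in> E. p \<in> path_image (\<gamma> e)} = 3)"

definition planar_graph :: "'a set \<Rightarrow> 'a set set \<Rightarrow> bool" where
  "planar_graph V E \<longleftrightarrow> (\<exists>pos \<gamma>. drawing V E pos \<gamma> \<and> crossing_points E \<gamma> = {})"

definition tcr :: "'a set \<Rightarrow> 'a set set \<Rightarrow> enat" where
  "tcr V E =
     (if planar_graph V E then 0
      else if \<nexists>pos \<gamma>. semi_regular_drawing V E pos \<gamma> then \<infinity>
      else enat (LEAST n. \<exists>pos \<gamma>. semi_regular_drawing V E pos \<gamma> \<and>
                                  n = card (crossing_points E \<gamma>)))"

end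

theory Submission
  imports Defs
begin

text \<open>Turn each of the \<open>k\<close> triple crossing points into a vertex. This adds \<open>k\<close> vertices and
  \<open>3k\<close> edges, and the resulting plane graph is simple because two edges of a drawing share at most
  one point. Hence \<open>|E| + 3k \<le> 3 (|V| + k) - 6\<close>, that is \<open>|E| \<le> 3 |V| - 6\<close>; but a complete
  \<open>t\<close>-partite graph with \<open>t \<ge> 5\<close> has at least \<open>4 |V| - 10\<close> edges. The bound for plane
  graphs comes from Euler's formula: by the Jordan curve theorem an arc closing a cycle splits a
  face, by Janiszewski's theorem an arc on a cycle borders at most two faces, and every face borders
  at least three arcs because two arcs with at most one common point do not separate the plane.\<close>

subsection \<open>Components under refinement\<close>

text \<open>On \<open>A\<close> the map \<open>g\<close> factors as \<open>h \<circ> f\<close>, so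
  its image is the image under \<open>h\<close> of the finite set of values of \<open>f\<close>. A
  pair that \<open>g\<close> identifies and \<open>f\<close> separates makes \<open>h\<close>
  non-injective, hence the count drops. This serves both for faces and for path classes of
  points.\<close>

lemma card_image_coarser:
  assumes fin: "finite (f ` A)"
    and coarser: "\<And>x y. x \<in> A \<Longrightarrow> y \<in> A \<Longrightarrow> f x = f y \<Longrightarrow> g x = g y"
  shows finite_image_coarser: "finite (g ` A)"
    and card_image_coarser_le: "card (g ` A) \<le> card (f ` A)"
    and card_image_coarser_less:
      "\<And>x y. x \<in> A \<Longrightarrow> y \<in> A \<Longrightarrow> f x \<noteq> f y \<Longrightarrow> g x = g y \<Longrightarrow> card (g ` A) < card (f ` A)"
proof -
  define h where "h = g \<circ> inv_into A f"
  have h: "h (f x) = g x" if "x \<in> A" for x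
    using coarser[of "inv_into A f (f x)" x] that
    by (simp add: h_def inv_into_into f_inv_into_f)
  then have img: "g ` A = h ` f ` A"
    by force
  show "finite (g ` A)" "card (g ` A) \<le> card (f ` A)"
    using fin by (simp_all add: img card_image_le)
  show "card (g ` A) < card (f ` A)"
    if "x \<in> A" "y \<in> A" "f x \<noteq> f y" "g x = g y" for x y
  proof -
    have "\<not> inj_on h (f ` A)"
      using that h by (metis image_eqI inj_onD)
    then have "card (h ` f ` A) \<noteq> card (f ` A)"
      using fin eq_card_imp_inj_on by blast
    then show ?thesis
      using \<open>card (g ` A) \<le> card (f ` A)\<close> by (simp add: img)
  qed
qed

text \<open>Every component of \<open>U\<close> meets \<open>W\<close>, so the components of
  \<open>U\<close> and of \<open>W\<close> are both indexed by points of \<open>W\<close>, and the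
  indexing by components of \<open>U\<close> is the coarser one.\<close>

lemma card_components_refine:
  assumes "W \<subseteq> U" and meet: "\<And>D. D \<in> components U \<Longrightarrow> D \<inter> W \<noteq> {}"
    and fin: "finite (components W)"
  shows finite_components_coarser: "finite (components U)"
    and card_components_coarser_le: "card (components U) \<le> card (components W)"
    and card_components_coarser_less:
      "\<And>x y. x \<in> W \<Longrightarrow> y \<in> W \<Longrightarrow> \<not> connected_component W x y \<Longrightarrow> connected_component U x y
        \<Longrightarrow> card (components U) < card (components W)"
proof -
  define f g where "f = connected_component_set W" and "g = connected_component_set U"
  have f: "f x = f y \<longleftrightarrow> connected_component W x y" if "x \<in> W" for x y
    using that by (auto simp: f_def connected_component_eq_eq dest: connected_component_in)
  have g: "g x = g y \<longleftrightarrow> connected_component U x y" if "x \<in> U" for x y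
    using that by (auto simp: g_def connected_component_eq_eq dest: connected_component_in)
  have W: "components W = f ` W"
    by (simp add: components_def f_def)
  have U: "components U = g ` W"
  proof
    show "components U \<subseteq> g ` W"
    proof
      fix D assume D: "D \<in> components U"
      then obtain x where x: "x \<in> D" "x \<in> W"
        using meet by blast
      obtain z where z: "z \<in> U" "D = g z"
        using D unfolding g_def by (auto simp: components_iff)
      then have "g z = g x"
        using g x(1) unfolding g_def by simp
      then show "D \<in> g ` W"
        using x(2) z(2) by blast
    qed
    show "g ` W \<subseteq> components U"
      using \<open>W \<subseteq> U\<close> unfolding g_def by (auto intro: componentsI)
  qed
  have coarser: "g x = g y" if "x \<in> W" "y \<in> W" "f x = f y" for x y
    using that f g \<open>W \<subseteq> U\<close> connected_component_of_subset[OF _ \<open>W \<subseteq> U\<close>] by blast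
  have fin': "finite (f ` W)"
    using fin W by simp
  note c = card_image_coarser[where f = f and g = g, OF fin' coarser]
  show "finite (components U)" "card (components U) \<le> card (components W)"
    unfolding U W by (rule c(1,2), assumption+)+
  show "card (components U) < card (components W)"
    if "x \<in> W" "y \<in> W" "\<not> connected_component W x y" "connected_component U x y" for x y
    unfolding U W using c(3)[of x y] that f g \<open>W \<subseteq> U\<close> by blast
qed

subsection \<open>Arcs in the plane\<close>

text \<open>An arc is homeomorphic to an interval, so a nonempty open set inside it would embed in
  the line, against invariance of dimension.\<close>

lemma interior_arc_image_empty:
  fixes g :: "real \<Rightarrow> complex"
  assumes "arc g"
  shows "interior (path_image g) = {}"
proof (rule ccontr)
  assume ne: "interior (path_image g) \<noteq> {}"
  obtain f k where fk: "homeomorphism (path_image g) {0..1::real} f k"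
    using homeomorphic_arc_image_interval[OF assms, of 0 1] by (auto simp: homeomorphic_def)
  have "DIM(complex) \<le> DIM(real)"
  proof (rule invariance_of_dimension[of "interior (path_image g)" f])
    show "continuous_on (interior (path_image g)) f"
      using fk interior_subset continuous_on_subset unfolding homeomorphism_def by blast
    show "inj_on f (interior (path_image g))"
      using fk interior_subset unfolding homeomorphism_def by (metis inj_on_def subsetD)
  qed (use ne in auto)
  then show False by simp
qed

lemma simple_loop_of_arcs:
  fixes g h :: "real \<Rightarrow> complex"
  assumes "arc g" "arc h" "pathstart h = pathstart g" "pathfinish h = pathfinish g"
    and "path_image g \<inter> path_image h \<subseteq> {pathstart g, pathfinish g}"
  obtains c where "simple_path c" "pathfinish c = pathstart c"
    "path_image c = path_image g \<union> path_image h"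
proof
  let ?c = "g +++ reversepath h"
  show "simple_path ?c"
    by (rule simple_path_join_loop) (use assms in \<open>auto simp: arc_reversepath\<close>)
  show "pathfinish ?c = pathstart ?c" "path_image ?c = path_image g \<union> path_image h"
    using assms by (simp_all add: path_image_join)
qed

lemma not_connected_component_inside_outside:
  fixes c :: "real \<Rightarrow> complex"
  assumes "x \<in> inside (path_image c)" "y \<in> outside (path_image c)" "path_image c \<subseteq> G"
  shows "\<not> connected_component (- G) x y"
proof
  assume "connected_component (- G) x y"
  then have "connected_component (- path_image c) x y"
    using assms(3) by (metis Compl_subset_Compl_iff connected_component_of_subset)
  then show False
    using assms(1,2) inside_same_component
    by (metis IntI empty_iff inside_Int_outside)
qed

lemma path_component_set_eqI:
  "path_component S x y \<Longrightarrow> path_component_set S x = path_component_set S y"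
  by (blast intro: path_component_sym path_component_trans)

subsection \<open>Plane systems of non-crossing arcs\<close>

locale plane_arcs =
  fixes P :: "complex set" and I :: "'i set" and s :: "'i \<Rightarrow> real \<Rightarrow> complex"
  assumes finite_points: "finite P" and finite_index: "finite I"
    and arc_s: "i \<in> I \<Longrightarrow> arc (s i)"
    and points_on: "i \<in> I \<Longrightarrow> path_image (s i) \<inter> P = {pathstart (s i), pathfinish (s i)}"
    and meet_at_points: "\<lbrakk>i \<in> I; j \<in> I; i \<noteq> j\<rbrakk> \<Longrightarrow> path_image (s i) \<inter> path_image (s j) \<subseteq> P"
begin

text \<open>All of \<open>P\<close> belongs to the drawn graph whatever \<open>J\<close> is. Arcs
  can thus be added one at a time over a fixed vertex set, and a point without arcs forms a path
  class of its own.\<close>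

definition support :: "'i set \<Rightarrow> complex set" where
  "support J = P \<union> (\<Union>j\<in>J. path_image (s j))"

lemma support_insert: "support (insert i J) = path_image (s i) \<union> support J"
  by (auto simp: support_def)

lemma support_mono: "J \<subseteq> K \<Longrightarrow> support J \<subseteq> support K"
  by (auto simp: support_def)

lemma closed_support: "J \<subseteq> I \<Longrightarrow> closed (support J)"
  unfolding support_def using finite_subset[OF _ finite_index]
  by (intro closed_Un closed_UN finite_imp_closed finite_points)
    (auto intro: closed_arc_image arc_s)

lemma ends_in_points: "i \<in> I \<Longrightarrow> pathstart (s i) \<in> P \<and> pathfinish (s i) \<in> P"
  using points_on by blast

lemma arc_meets_support:
  assumes "i \<in> I" "J \<subseteq> I" "i \<notin> J"
  shows "path_image (s i) \<inter> support J = {pathstart (s i), pathfinish (s i)}"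
  using assms points_on[OF assms(1)] meet_at_points[OF assms(1)] unfolding support_def by fast

lemma arc_interior_avoids_support:
  assumes "i \<in> I" "J \<subseteq> I" "i \<notin> J"
  shows "path_image (s i) - P \<subseteq> - support J"
proof
  fix x assume x: "x \<in> path_image (s i) - P"
  have "x \<notin> {pathstart (s i), pathfinish (s i)}"
    using x ends_in_points[OF assms(1)] by auto
  then show "x \<in> - support J"
    using x arc_meets_support[OF assms] by blast
qed

section \<open>Faces under insertion of an arc, and Euler's inequality\<close>

lemma faces_insert_arc:
  assumes "J \<subseteq> I" "i \<in> I" "finite (components (- support (insert i J)))"
  shows "finite (components (- support J))"
    and "card (components (- support J)) \<le> card (components (- support (insert i J)))"
    and "\<And>x y. \<lbrakk>x \<in> - support (insert i J); y \<in> - support (insert i J);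
            \<not> connected_component (- support (insert i J)) x y; connected_component (- support J) x y\<rbrakk>
          \<Longrightarrow> card (components (- support J)) < card (components (- support (insert i J)))"
proof -
  have sub: "- support (insert i J) \<subseteq> - support J"
    using support_mono[of J "insert i J"] by blast
  \<comment> \<open>No old face is swallowed: a face is open, and the new arc has empty
    interior.\<close>
  have meet: "D \<inter> - support (insert i J) \<noteq> {}" if "D \<in> components (- support J)" for D
  proof
    assume "D \<inter> - support (insert i J) = {}"
    then have "D \<subseteq> path_image (s i)"
      using in_components_subset[OF that] by (auto simp: support_insert)
    moreover have "open D"
      using that open_components closed_support[OF assms(1)] by (metis open_Compl)
    ultimately have "D \<subseteq> interior (path_image (s i))"
      by (rule interior_maximal)
    then show False
      using interior_arc_image_empty[OF arc_s[OF assms(2)]] in_components_nonempty[OF that] by simp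
  qed
  note c = card_components_refine[OF sub meet assms(3)]
  show "finite (components (- support J))"
    "card (components (- support J)) \<le> card (components (- support (insert i J)))"
    using c(1,2) by blast+
  show "\<And>x y. \<lbrakk>x \<in> - support (insert i J); y \<in> - support (insert i J);
            \<not> connected_component (- support (insert i J)) x y; connected_component (- support J) x y\<rbrakk>
          \<Longrightarrow> card (components (- support J)) < card (components (- support (insert i J)))"
    using c(3) by blast
qed

text \<open>A path between the ends of \<open>s i\<close> in the rest of the graph contains an arc
  \<open>h\<close>, which closes \<open>s i\<close> to a Jordan curve. The last equation holds
  because \<open>s i\<close> meets the rest only in its ends; it is the form in which Janiszewski's
  theorem is applied later.\<close>

lemma loop_through_arc:
  assumes "i \<in> I" "J \<subseteq> I" "i \<notin> J"
    and conn: "path_component (support J) (pathstart (s i)) (pathfinish (s i))"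
  obtains h c where "arc h" "path_image h \<subseteq> support J"
    "simple_path c" "pathfinish c = pathstart c" "path_image c = path_image (s i) \<union> path_image h"
    "path_image c \<inter> support J = path_image h"
proof -
  obtain p where p: "path p" "path_image p \<subseteq> support J" "pathstart p = pathstart (s i)"
      "pathfinish p = pathfinish (s i)"
    using conn unfolding path_component_def by blast
  have ne: "pathstart (s i) \<noteq> pathfinish (s i)"
    using arc_distinct_ends[OF arc_s[OF assms(1)]] by simp
  obtain h where h: "arc h" "path_image h \<subseteq> path_image p" "pathstart h = pathstart (s i)"
      "pathfinish h = pathfinish (s i)"
    using path_contains_arc[OF p(1,3,4) ne] by blast
  have meet: "path_image (s i) \<inter> support J = {pathstart (s i), pathfinish (s i)}"
    by (rule arc_meets_support) fact+
  have hJ: "path_image h \<subseteq> support J"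
    using h(2) p(2) by blast
  have *: "path_image (s i) \<inter> path_image h \<subseteq> {pathstart (s i), pathfinish (s i)}"
    using meet hJ by blast
  obtain c where c: "simple_path c" "pathfinish c = pathstart c"
      "path_image c = path_image (s i) \<union> path_image h"
    using simple_loop_of_arcs[OF arc_s[OF assms(1)] h(1,3,4) *] by blast
  have "{pathstart (s i), pathfinish (s i)} \<subseteq> path_image h"
    using pathstart_in_path_image[of h] pathfinish_in_path_image[of h] h(3,4) by simp
  then have "path_image c \<inter> support J = path_image h"
    unfolding c(3) using meet hJ by blast
  then show ?thesis
    using that h(1) hJ c by blast
qed

lemma interior_point_of_arc:
  assumes "i \<in> I"
  obtains x where "x \<in> path_image (s i)" "x \<notin> P"
proof -
  have "infinite (path_image (s i))"
    using arc_s[OF assms] arc_image_uncountable uncountable_infinite by blast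
  then have "\<not> path_image (s i) \<subseteq> P"
    using finite_points finite_subset by blast
  then show ?thesis
    using that by blast
qed

text \<open>Every point of a Jordan curve is in the frontier of both its sides. The old face around
  an interior point \<open>x\<close> of the arc therefore has points inside and outside the loop,
  and these fall into different faces once the arc is drawn.\<close>

lemma arc_splits_face:
  assumes "i \<in> I" "J \<subseteq> I" "i \<notin> J"
    and conn: "path_component (support J) (pathstart (s i)) (pathfinish (s i))"
    and fin: "finite (components (- support (insert i J)))"
  shows "card (components (- support J)) < card (components (- support (insert i J)))"
proof -
  obtain h c where h: "arc h" "path_image h \<subseteq> support J"
    and c: "simple_path c" "pathfinish c = pathstart c" "path_image c = path_image (s i) \<union> path_image h"
    by (rule loop_through_arc[OF assms(1-4)])
  note J = Jordan_inside_outside[OF c(1,2)]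
  obtain x where x: "x \<in> path_image (s i)" "x \<notin> P"
    by (rule interior_point_of_arc[OF assms(1)])
  have xJ: "x \<in> - support J"
    using arc_interior_avoids_support[OF assms(1-3)] x by blast
  define D where "D = connected_component_set (- support J) x"
  have "open D"
    using closed_support[OF assms(2)] by (simp add: D_def open_Compl open_connected_component)
  have "x \<in> D"
    using xJ by (simp add: D_def)
  have DJ: "D \<subseteq> - support J"
    by (simp add: D_def connected_component_subset)
  have "x \<in> closure (inside (path_image c))" "x \<in> closure (outside (path_image c))"
    using J x(1) c(3) unfolding frontier_def by blast+
  then have "D \<inter> inside (path_image c) \<noteq> {}" "D \<inter> outside (path_image c) \<noteq> {}"
    using open_Int_closure_eq_empty[OF \<open>open D\<close>] \<open>x \<in> D\<close> by blast+
  then obtain p q where p: "p \<in> D" "p \<in> inside (path_image c)"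
    and q: "q \<in> D" "q \<in> outside (path_image c)"
    by blast
  have "p \<notin> path_image c" "q \<notin> path_image c"
    using p(2) q(2) inside_no_overlap outside_no_overlap by blast+
  then have pq: "p \<in> - support (insert i J)" "q \<in> - support (insert i J)"
    using p(1) q(1) DJ unfolding c(3) support_insert by blast+
  moreover have "\<not> connected_component (- support (insert i J)) p q"
    using not_connected_component_inside_outside[OF p(2) q(2)] h(2) c(3) support_insert by blast
  moreover have "connected_component (- support J) p q"
    using p(1) q(1) unfolding D_def by (metis connected_component_sym connected_component_trans mem_Collect_eq)
  ultimately show ?thesis
    by (rule faces_insert_arc(3)[OF assms(2,1) fin])
qed

text \<open>Here \<open>finite\<close> has to be assumed since \<open>card\<close> of an infinite set of faces would be \<open>0\<close>. For the
  whole graph it follows below from the count of bordering faces.\<close>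

lemma Euler_inequality:
  assumes "J \<subseteq> I" "finite (components (- support J))"
  shows "card J + 1 + card (path_component_set (support J) ` P) \<le> card P + card (components (- support J))"
proof -
  have "finite J" using assms(1) finite_index finite_subset by blast
  then show ?thesis
    using assms
  proof (induction J)
    case empty
    \<comment> \<open>Without arcs there are at most \<open>card P\<close> path classes, and there
      is at least one face since a bounded set does not fill the plane.\<close>
    have "bounded (support {})"
      by (simp add: support_def finite_points finite_imp_bounded)
    then have "- support {} \<noteq> {}"
      by (metis Compl_empty_eq double_complement not_bounded_UNIV)
    then have "card (components (- support {})) \<noteq> 0"
      using empty by simp
    then show ?case
      using card_image_le[OF finite_points, of "path_component_set (support {})"] by simp
  next
    case (insert i J)
    then have iJ: "i \<in> I" "J \<subseteq> I" "i \<notin> J" by auto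
    note fin = insert.prems(2)
    note cmp = faces_insert_arc[OF iJ(2,1) fin]
    define f where "f x = path_component_set (support J) x" for x
    define g where "g x = path_component_set (support (insert i J)) x" for x
    have f: "f x = f y \<longleftrightarrow> path_component (support J) x y" if "y \<in> support J" for x y
    proof
      assume "f x = f y"
      moreover have "y \<in> f y"
        using that path_component_refl by (simp add: f_def)
      ultimately have "y \<in> f x" by (rule ssubst)
      then show "path_component (support J) x y" by (simp add: f_def)
    qed (simp add: f_def path_component_set_eqI)
    have g: "g x = g y" if "path_component (support (insert i J)) x y" for x y
      unfolding g_def using that by (rule path_component_set_eqI)
    have IH: "card J + 1 + card (f ` P) \<le> card P + card (components (- support J))"
      using insert.IH iJ(2) cmp(1) unfolding f_def by blast
    have card_insert: "card (insert i J) = card J + 1"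
      using insert.hyps by simp
    have P: "P \<subseteq> support J" by (simp add: support_def)
    have sub: "support J \<subseteq> support (insert i J)" by (rule support_mono) blast
    have coarser: "g x = g y" if "x \<in> P" "y \<in> P" "f x = f y" for x y
    proof -
      have "path_component (support J) x y"
        using that f P by blast
      then have "path_component (support (insert i J)) x y"
        using sub path_component_of_subset by blast
      then show ?thesis
        by (rule g)
    qed
    have finf: "finite (f ` P)" using finite_points by simp
    note cc = card_image_coarser[where f = f and g = g, OF finf coarser]
    let ?a = "pathstart (s i)" and ?b = "pathfinish (s i)"
    \<comment> \<open>The new arc either closes a cycle, which adds a face, or joins two path
      classes of points. Either change makes up for the increase of \<open>card J\<close> by
      one.\<close>
    have "card (insert i J) + 1 + card (g ` P) \<le> card P + card (components (- support (insert i J)))"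
    proof (cases "path_component (support J) ?a ?b")
      case True
      then show ?thesis
        using arc_splits_face[OF iJ True fin] cc(2) IH card_insert by linarith
    next
      case False
      have ab: "?a \<in> P" "?b \<in> P" using ends_in_points iJ(1) by auto
      have "f ?a \<noteq> f ?b"
        using False ab P f by blast
      moreover have "path_component (support (insert i J)) ?a ?b"
        unfolding path_component_def using arc_imp_path[OF arc_s[OF iJ(1)]] support_insert by blast
      then have "g ?a = g ?b"
        by (rule g)
      ultimately have "card (g ` P) < card (f ` P)"
        using cc(3) ab by blast
      then show ?thesis
        using cmp(2) IH card_insert by linarith
    qed
    then show ?case
      unfolding g_def .
  qed
qed

section \<open>Incidence of arcs and faces\<close>

text \<open>Contact at a point of \<open>P\<close> does not count, since many faces may touch an arc
  at one of its ends.\<close>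

definition borders :: "'i \<Rightarrow> complex set \<Rightarrow> bool" where
  "borders i D \<longleftrightarrow> (path_image (s i) - P) \<inter> frontier D \<noteq> {}"

lemma arc_interior_connected:
  assumes "i \<in> I"
  shows "connected (path_image (s i) - P)"
proof -
  have arc: "arc (s i)" by (rule arc_s) fact
  have "path_image (s i) - P = path_image (s i) - {pathstart (s i), pathfinish (s i)}"
    using points_on[OF assms] by blast
  also have "\<dots> = s i ` {0<..<1}"
  proof -
    have "{0..1} - {0, 1} = {0<..<1::real}" by auto
    moreover have "s i ` ({0..1} - {0, 1}) = s i ` {0..1} - s i ` {0, 1}"
      by (rule inj_on_image_set_diff[OF arc_imp_inj_on[OF arc]]) auto
    ultimately show ?thesis
      by (simp add: path_image_def pathstart_def pathfinish_def)
  qed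
  also have "connected \<dots>"
    using arc unfolding arc_def path_def
    by (intro connected_continuous_image) (auto elim: continuous_on_subset)
  finally show ?thesis .
qed

text \<open>When the arc is erased, its interior becomes a connected set off the remaining graph. A
  bordering face comes arbitrarily close to some point of it, so one can pass from \<open>D1\<close>
  to the arc, along it, and into \<open>D2\<close>.\<close>

lemma connected_component_of_bordering_faces:
  assumes i: "i \<in> I" and D: "borders i D1" "borders i D2"
  obtains p q where "p \<in> D1" "q \<in> D2" "connected_component (- support (I - {i})) p q"
proof -
  let ?U = "- support (I - {i})"
  have op: "open (connected_component_set ?U x)" for x
    using closed_support[of "I - {i}"] by (simp add: open_Compl open_connected_component)
  have sub: "path_image (s i) - P \<subseteq> ?U"
    by (rule arc_interior_avoids_support) (use i in auto)
  have near: "\<exists>x p. x \<in> path_image (s i) - P \<and> p \<in> D \<and> connected_component ?U x p"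
    if bD: "borders i D" for D
  proof -
    obtain x where x: "x \<in> path_image (s i) - P" "x \<in> closure D"
      using bD unfolding borders_def frontier_def by blast
    have "x \<in> connected_component_set ?U x"
      using x(1) sub by auto
    then have "connected_component_set ?U x \<inter> D \<noteq> {}"
      using open_Int_closure_eq_empty[OF op] x(2) by blast
    then show ?thesis using x(1) by blast
  qed
  obtain x p where x: "x \<in> path_image (s i) - P" and p: "p \<in> D1" "connected_component ?U x p"
    using near[OF D(1)] by blast
  obtain y q where y: "y \<in> path_image (s i) - P" and q: "q \<in> D2" "connected_component ?U y q"
    using near[OF D(2)] by blast
  have "connected_component ?U x y"
    using arc_interior_connected[OF i] sub x y by (rule connected_componentI)
  then have "connected_component ?U p q"
    using p(2) q(2) by (meson connected_component_sym connected_component_trans)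
  then show ?thesis using that p(1) q(1) by blast
qed

text \<open>The loop \<open>c\<close> through the arc meets the rest of the graph in the arc \<open>h\<close>, which is connected. So
  by Janiszewski's theorem two bordering faces on the same side of \<open>c\<close> coincide: their points are
  joined off \<open>c\<close> within that side, and off the rest of the graph along the interior of the arc.\<close>

lemma bordering_faces:
  assumes i: "i \<in> I"
    and conn: "path_component (support (I - {i})) (pathstart (s i)) (pathfinish (s i))"
  shows "finite {D \<in> components (- support I). borders i D}"
    and "card {D \<in> components (- support I). borders i D} \<le> 2"
proof -
  let ?J = "I - {i}" and ?F = "{D \<in> components (- support I). borders i D}"
  have iJ: "i \<in> I" "?J \<subseteq> I" "i \<notin> ?J" using i by auto
  obtain h c where h: "arc h"
    and c: "simple_path c" "pathfinish c = pathstart c" "path_image c = path_image (s i) \<union> path_image h"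
      "path_image h \<subseteq> support ?J" "path_image c \<inter> support ?J = path_image h"
    by (rule loop_through_arc[OF iJ conn])
  note J = Jordan_inside_outside[OF c(1,2)]
  have I: "support I = path_image c \<union> support ?J"
    using support_insert[of i ?J] c(3,4) i by (simp add: insert_absorb Un_absorb1 Un_assoc)
  have side: "D \<subseteq> inside (path_image c) \<or> D \<subseteq> outside (path_image c)"
    if "D \<in> components (- support I)" for D
  proof -
    have "D \<subseteq> inside (path_image c) \<union> outside (path_image c)"
      using J in_components_subset[OF that] I by blast
    moreover have "inside (path_image c) \<inter> D = {} \<or> outside (path_image c) \<inter> D = {}"
      using J in_components_connected[OF that] calculation by (intro connectedD) auto
    ultimately show ?thesis by blast
  qed
  \<comment> \<open>The side of \<open>c\<close> is recorded as a truth value, so injectivity yields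
    both finiteness and the bound \<open>2\<close>.\<close>
  have inj: "inj_on (\<lambda>D. D \<subseteq> inside (path_image c)) ?F"
  proof (rule inj_onI)
    fix D1 D2 assume D1: "D1 \<in> ?F" and D2: "D2 \<in> ?F"
      and same: "(D1 \<subseteq> inside (path_image c)) = (D2 \<subseteq> inside (path_image c))"
    obtain p q where p: "p \<in> D1" and q: "q \<in> D2" and pq: "connected_component (- support ?J) p q"
      using connected_component_of_bordering_faces[OF i, of D1 D2] D1 D2 by blast
    have "p \<in> inside (path_image c) \<and> q \<in> inside (path_image c) \<or>
        p \<in> outside (path_image c) \<and> q \<in> outside (path_image c)"
      using side D1 D2 same p q by blast
    then have "connected_component (- path_image c) p q"
      using J by (metis connected_componentI sup.cobounded1 sup.cobounded2)
    moreover have "connected (path_image c \<inter> support ?J)"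
      unfolding c(5) using h by (rule connected_arc_image)
    ultimately have "connected_component (- support I) p q"
      unfolding I using Janiszewski[OF compact_simple_path_image[OF c(1)] closed_support[OF iJ(2)]] pq
      by blast
    then obtain T where "connected T" "T \<subseteq> - support I" "p \<in> T" "q \<in> T"
      unfolding connected_component_def by blast
    then have "T \<subseteq> D1" "T \<subseteq> D2"
      using D1 D2 p q components_maximal[of D1 "- support I" T] components_maximal[of D2 "- support I" T]
      by auto
    then show "D1 = D2"
      using D1 D2 \<open>p \<in> T\<close> components_eq[of D1 "- support I" D2] by auto
  qed
  show "finite ?F"
    using inj_on_finite[OF inj, of UNIV] by simp
  show "card ?F \<le> 2"
    using card_inj_on_le[OF inj, of UNIV] by (simp add: card_UNIV_bool)
qed

text \<open>Otherwise the frontier of \<open>D\<close> lies in the points and two arcs; these do not separate the plane, so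
  \<open>D\<close> would be their whole complement and contain the interior of a third arc.\<close>

lemma face_borders_three_arcs:
  assumes D: "D \<in> components (- support I)" and "3 \<le> card I"
    and simple: "\<And>i j. \<lbrakk>i \<in> I; j \<in> I; i \<noteq> j\<rbrakk> \<Longrightarrow> \<exists>p. path_image (s i) \<inter> path_image (s j) \<subseteq> {p}"
  shows "3 \<le> card {i \<in> I. borders i D}"
proof (rule ccontr)
  let ?T = "{i \<in> I. borders i D}"
  assume "\<not> ?thesis"
  \<comment> \<open>The bordering arcs are padded to exactly two, which treats zero, one and two of
    them alike.\<close>
  then obtain K where K: "?T \<subseteq> K" "K \<subseteq> I" "card K = 2"
    using exists_subset_between[of ?T 2 I] finite_index assms(2) by auto
  then obtain i j where ij: "K = {i, j}" "i \<noteq> j"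
    by (meson card_2_iff)
  have "card K < card I" using K(3) assms(2) by simp
  then obtain k where k: "k \<in> I" "k \<notin> K"
    using K(2) by (metis less_irrefl subsetI subset_antisym)
  have I: "i \<in> I" "j \<in> I" using K ij by auto
  let ?W = "path_image (s i) \<union> path_image (s j) \<union> P"
  \<comment> \<open>Neither arc separates the plane, and their intersection is connected, being
    empty or a single point; Janiszewski's theorem then applies to the union.\<close>
  have "connected (- (path_image (s i) \<union> path_image (s j)))"
  proof (rule Janiszewski_connected)
    obtain p where "path_image (s i) \<inter> path_image (s j) \<subseteq> {p}"
      using simple[OF I ij(2)] by blast
    then show "connected (path_image (s i) \<inter> path_image (s j))"
      by (metis connected_empty connected_sing subset_singletonD)
  qed (use I arc_s in \<open>auto intro!: compact_arc_image closed_arc_image connected_arc_complement\<close>)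
  then have "connected (- (path_image (s i) \<union> path_image (s j)) - P)"
    using I arc_s finite_points
    by (intro connected_open_delete_finite) (auto intro!: open_Compl closed_Un closed_arc_image)
  then have conn: "connected (- ?W)"
    by (simp add: Diff_eq Compl_Un)
  obtain z where z: "z \<in> path_image (s k)" "z \<notin> P"
    by (rule interior_point_of_arc[OF k(1)])
  have "z \<notin> ?W"
    using z meet_at_points[OF k(1) I(1)] meet_at_points[OF k(1) I(2)] k(2) ij by blast
  moreover have "z \<notin> D"
    using z(1) k(1) in_components_subset[OF D] unfolding support_def by blast
  ultimately have "- ?W - D \<noteq> {}" by blast
  moreover have "- ?W \<inter> D \<noteq> {}"
    using in_components_nonempty[OF D] in_components_subset[OF D] I unfolding support_def by blast
  ultimately have "- ?W \<inter> frontier D \<noteq> {}"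
    using connected_Int_frontier[OF conn] by blast
  moreover have "frontier D \<subseteq> support I"
    using frontier_of_components_closed_complement[OF closed_support[OF subset_refl] D] .
  ultimately obtain y l where y: "y \<in> frontier D" "y \<notin> ?W" and l: "l \<in> I" "y \<in> path_image (s l)"
    unfolding support_def by blast
  then have "l \<in> ?T" by (auto simp: borders_def)
  then show False using K(1) ij y l by blast
qed

text \<open>Counting bordering pairs in two ways gives \<open>3 * card ?F \<le> 2 * card I\<close>.
  Euler's inequality with at least one path class gives
  \<open>card I + 2 \<le> card P + card ?F\<close>; three times this, combined with the former, is
  the claim. The assumption \<open>conn\<close> says that no arc is a bridge.\<close>

theorem card_arcs_le:
  assumes "3 \<le> card I"
    and simple: "\<And>i j. \<lbrakk>i \<in> I; j \<in> I; i \<noteq> j\<rbrakk> \<Longrightarrow> \<exists>p. path_image (s i) \<inter> path_image (s j) \<subseteq> {p}"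
    and conn: "\<And>i. i \<in> I \<Longrightarrow> path_component (support (I - {i})) (pathstart (s i)) (pathfinish (s i))"
  shows "card I + 6 \<le> 3 * card P"
proof -
  let ?F = "components (- support I)"
  have three: "3 \<le> card {i \<in> I. borders i D}" if "D \<in> ?F" for D
    using face_borders_three_arcs[OF that assms(1)] simple by blast
  \<comment> \<open>Each face borders some arc and each of the finitely many arcs borders finitely
    many faces. This gives the finiteness that Euler's inequality asks for.\<close>
  have "?F \<subseteq> (\<Union>i\<in>I. {D \<in> ?F. borders i D})"
  proof
    fix D assume D: "D \<in> ?F"
    then have "{i \<in> I. borders i D} \<noteq> {}" using three[OF D] by (metis card.empty not_numeral_le_zero)
    then show "D \<in> (\<Union>i\<in>I. {D \<in> ?F. borders i D})" using D by blast
  qed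
  moreover have "finite (\<Union>i\<in>I. {D \<in> ?F. borders i D})"
    using finite_index bordering_faces(1) conn by blast
  ultimately have fin: "finite ?F" by (rule finite_subset)
  have "3 * card ?F = (\<Sum>D\<in>?F. 3)" by simp
  also have "\<dots> \<le> (\<Sum>D\<in>?F. card {i \<in> I. borders i D})"
    by (rule sum_mono) (rule three)
  also have "\<dots> = (\<Sum>i\<in>I. card {D \<in> ?F. borders i D})"
    using sum_multicount_gen[OF finite_index fin, of borders "\<lambda>D. card {i \<in> I. borders i D}"] by simp
  also have "\<dots> \<le> (\<Sum>i\<in>I. 2)"
    by (rule sum_mono) (use bordering_faces(2) conn in blast)
  finally have "3 * card ?F \<le> 2 * card I" by simp
  moreover have "card I + 1 + card (path_component_set (support I) ` P) \<le> card P + card ?F"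
    using Euler_inequality[OF subset_refl fin] .
  moreover have "card (path_component_set (support I) ` P) \<noteq> 0"
  proof -
    obtain i where "i \<in> I" using assms(1) by fastforce
    then have "P \<noteq> {}" using ends_in_points by blast
    then show ?thesis using finite_points by simp
  qed
  ultimately show ?thesis by linarith
qed

end

subsection \<open>Planarization of a semi-regular drawing\<close>

definition next_in :: "real set \<Rightarrow> real \<Rightarrow> real" where
  "next_in T t = Min {u \<in> T. t < u}"

lemma next_in:
  assumes "finite T" "T \<subseteq> {0..1}" "1 \<in> T" "t \<in> T - {1}"
  shows "next_in T t \<in> T" "t < next_in T t"
    and next_in_le: "\<And>u. u \<in> T \<Longrightarrow> t < u \<Longrightarrow> next_in T t \<le> u"
proof -
  have "t < 1"
    using assms(2,4) by force
  then have "{u \<in> T. t < u} \<noteq> {}" "finite {u \<in> T. t < u}"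
    using assms by auto
  then have "next_in T t \<in> {u \<in> T. t < u}"
    unfolding next_in_def by (intro Min_in)
  then show "next_in T t \<in> T" "t < next_in T t"
    by auto
  show "next_in T t \<le> u" if "u \<in> T" "t < u" for u
    unfolding next_in_def using that assms(1) by (intro Min_le) auto
qed

lemma next_in_cover:
  assumes "finite T" "T \<subseteq> {0..1}" "0 \<in> T" "1 \<in> T" "x \<in> {0..1}"
  obtains t where "t \<in> T - {1}" "x \<in> {t..next_in T t}"
proof -
  \<comment> \<open>Leaving out \<open>1\<close> puts \<open>x = 1\<close> at the end of the last
    interval.\<close>
  define t where "t = Max {u \<in> T - {1}. u \<le> x}"
  have fin: "finite {u \<in> T - {1}. u \<le> x}" "{u \<in> T - {1}. u \<le> x} \<noteq> {}"
    using assms by auto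
  then have t: "t \<in> {u \<in> T - {1}. u \<le> x}"
    unfolding t_def by (rule Max_in)
  have "x \<le> next_in T t"
  proof (rule ccontr)
    assume less: "\<not> x \<le> next_in T t"
    then have "next_in T t \<in> {u \<in> T - {1}. u \<le> x}"
      using next_in[OF assms(1,2,4)] t assms(5) by auto
    then have "next_in T t \<le> t"
      unfolding t_def using fin by (intro Max_ge)
    then show False
      using next_in(2)[OF assms(1,2,4), of t] t by auto
  qed
  then show ?thesis
    using that t by auto
qed

lemma path_component_path_image:
  assumes "path p" "path_image p \<subseteq> S" "x \<in> path_image p" "y \<in> path_image p"
  shows "path_component S x y"
  using path_component_path_image_pathstart[OF assms(1)] assms(2-4)
  by (meson path_component_of_subset path_component_sym path_component_trans)

text \<open>Everything the planarization needs of the graph is that it is finite and simple; the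
  multipartite structure enters only afterwards.\<close>

locale finite_drawing = drawing V E pos \<gamma>
  for V :: "'a set" and E :: "'a set set" and pos \<gamma> +
  assumes finite_V: "finite V"
    and edge: "e \<in> E \<Longrightarrow> e \<subseteq> V \<and> card e = 2"
    and triple: "p \<in> crossing_points E \<gamma> \<Longrightarrow> card {e \<in> E. p \<in> path_image (\<gamma> e)} = 3"
begin

abbreviation crossings :: "complex set" where
  "crossings \<equiv> crossing_points E \<gamma>"

definition points :: "complex set" where
  "points = pos ` V \<union> crossings"

definition params :: "'a set \<Rightarrow> real set" where
  "params e = {t \<in> {0..1}. \<gamma> e t \<in> points}"

text \<open>The pair \<open>(e, t)\<close> stands for the piece of \<open>e\<close> that starts at parameter \<open>t\<close>; no piece starts
  at \<open>1\<close>.\<close>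

definition segments :: "('a set \<times> real) set" where
  "segments = Sigma E (\<lambda>e. params e - {1})"

definition segment :: "'a set \<times> real \<Rightarrow> real \<Rightarrow> complex" where
  "segment = (\<lambda>(e, t). subpath t (next_in (params e) t) (\<gamma> e))"

section \<open>Counting points and segments\<close>

lemma finite_E: "finite E"
  using finite_V edge finite_subset[of E "Pow V"] by blast

text \<open>Disjoint edges share at most one point, so a crossing is determined by a pair of edges
  through it.\<close>

lemma finite_crossings: "finite crossings"
proof -
  have "crossings \<subseteq> (\<lambda>(e, f). THE p. p \<in> path_image (\<gamma> e) \<inter> path_image (\<gamma> f)) ` (E \<times> E)"
  proof
    fix p assume "p \<in> crossings"
    then obtain e f where ef: "e \<in> E" "f \<in> E" "e \<inter> f = {}"
        and p: "p \<in> path_image (\<gamma> e) \<inter> path_image (\<gamma> f)"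
      unfolding crossing_points_def by blast
    have "(THE p. p \<in> path_image (\<gamma> e) \<inter> path_image (\<gamma> f)) = p"
      using p disjoint_edges_once[OF ef _ p] by (intro the_equality)
    then show "p \<in> (\<lambda>(e, f). THE p. p \<in> path_image (\<gamma> e) \<inter> path_image (\<gamma> f)) ` (E \<times> E)"
      using ef by force
  qed
  then show ?thesis
    using finite_E by (meson finite_SigmaI finite_imageI finite_subset)
qed

lemma finite_points: "finite points"
  using finite_crossings finite_V by (simp add: points_def)

lemma vertex_on_edge:
  assumes "e \<in> E" "v \<in> V" "pos v \<in> path_image (\<gamma> e)"
  shows "v \<in> e"
proof -
  have "pos v \<in> pos ` e"
    using interior_edge[OF assms(1)] assms(2,3) by blast
  then show ?thesis
    using inj_pos edge[OF assms(1)] assms(2) by (auto dest: inj_onD)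
qed

text \<open>A vertex placed at a crossing would be an end of two disjoint edges.\<close>

lemma crossing_not_vertex: "crossings \<inter> pos ` V = {}"
  using vertex_on_edge unfolding crossing_points_def by fastforce

lemma ends_subset: "e \<in> E \<Longrightarrow> pos ` e \<subseteq> path_image (\<gamma> e)"
  using ends_edge by (metis empty_subsetI insert_subset pathfinish_in_path_image pathstart_in_path_image)

lemma points_on_edge:
  assumes "e \<in> E"
  shows "path_image (\<gamma> e) \<inter> points = pos ` e \<union> (path_image (\<gamma> e) \<inter> crossings)"
  using interior_edge[OF assms] ends_subset[OF assms] edge[OF assms] by (auto simp: points_def)

lemma card_points: "card points = card V + card crossings"
  unfolding points_def using crossing_not_vertex finite_crossings finite_V card_image[OF inj_pos]
  by (subst card_Un_disjoint) auto

lemma params: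
  assumes "e \<in> E"
  shows "finite (params e)" "params e \<subseteq> {0..1}" "0 \<in> params e" "1 \<in> params e"
    and card_params: "card (params e) = 2 + card {p \<in> crossings. p \<in> path_image (\<gamma> e)}"
proof -
  have inj: "inj_on (\<gamma> e) (params e)"
    using arc_imp_inj_on[OF arc_edge[OF assms]] by (rule inj_on_subset) (auto simp: params_def)
  have img: "\<gamma> e ` params e = path_image (\<gamma> e) \<inter> points"
    by (auto simp: params_def path_image_def)
  show fin: "finite (params e)"
    using finite_points img inj by (metis finite_Int finite_imageD)
  show "params e \<subseteq> {0..1}"
    by (auto simp: params_def)
  have "{\<gamma> e 0, \<gamma> e 1} \<subseteq> points"
    using ends_edge[OF assms] edge[OF assms] by (auto simp: points_def pathstart_def pathfinish_def)
  then show "0 \<in> params e" "1 \<in> params e"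
    by (auto simp: params_def)
  have "card (params e) = card (pos ` e \<union> (path_image (\<gamma> e) \<inter> crossings))"
    using card_image[OF inj] img points_on_edge[OF assms] by simp
  also have "\<dots> = card (pos ` e) + card (path_image (\<gamma> e) \<inter> crossings)"
    using crossing_not_vertex finite_crossings edge[OF assms] finite_V
    by (intro card_Un_disjoint) (auto intro: finite_subset)
  also have "card (pos ` e) = 2"
    using edge[OF assms] inj_pos card_image inj_on_subset by metis
  also have "path_image (\<gamma> e) \<inter> crossings = {p \<in> crossings. p \<in> path_image (\<gamma> e)}"
    by blast
  finally show "card (params e) = 2 + card {p \<in> crossings. p \<in> path_image (\<gamma> e)}" .
qed

text \<open>An edge with \<open>c\<close> crossings has \<open>c + 2\<close> parameters, and a
  segment starts at each of them except \<open>1\<close>. The sum of all \<open>c\<close> is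
  \<open>3 * card crossings\<close>, as exactly three edges pass through each crossing.\<close>

lemma card_segments: "card segments = card E + 3 * card crossings"
proof -
  have "card segments = (\<Sum>e\<in>E. card (params e - {1}))"
    unfolding segments_def using finite_E params by simp
  also have "\<dots> = (\<Sum>e\<in>E. 1 + card {p \<in> crossings. p \<in> path_image (\<gamma> e)})"
    by (rule sum.cong) (use params card_params in auto)
  also have "\<dots> = card E + (\<Sum>e\<in>E. card {p \<in> crossings. p \<in> path_image (\<gamma> e)})"
    by (simp only: sum.distrib) simp
  also have "(\<Sum>e\<in>E. card {p \<in> crossings. p \<in> path_image (\<gamma> e)}) = 3 * card crossings"
    using sum_multicount_gen[OF finite_E finite_crossings,
        of "\<lambda>e p. p \<in> path_image (\<gamma> e)" "\<lambda>_. 3"] triple by simp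
  finally show ?thesis .
qed

section \<open>Segments as a plane system of arcs\<close>

lemma path_image_segment:
  assumes "(e, t) \<in> segments"
  shows "path_image (segment (e, t)) = \<gamma> e ` {t..next_in (params e) t}"
  using next_in(2)[of "params e" t] params[of e] assms
  by (auto simp: segments_def segment_def path_image_subpath)

lemma segmentD:
  assumes "(e, t) \<in> segments"
  shows "e \<in> E" "t \<in> params e" "next_in (params e) t \<in> params e" "t < next_in (params e) t"
    "0 \<le> t" "next_in (params e) t \<le> 1"
    and next_param: "\<And>u. u \<in> params e \<Longrightarrow> t < u \<Longrightarrow> next_in (params e) t \<le> u"
proof -
  show e: "e \<in> E" and t: "t \<in> params e"
    using assms by (auto simp: segments_def)
  have t': "t \<in> params e - {1}"
    using assms by (auto simp: segments_def)
  note n = next_in[OF params(1,2,4)[OF e] t']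
  show "next_in (params e) t \<in> params e" "t < next_in (params e) t"
    by (rule n(1), rule n(2))
  show "0 \<le> t" "next_in (params e) t \<le> 1"
    using t n(1) by (auto simp: params_def)
  show "\<And>u. u \<in> params e \<Longrightarrow> t < u \<Longrightarrow> next_in (params e) t \<le> u"
    by (rule n(3))
qed

lemma edge_eqD:
  "\<lbrakk>e \<in> E; \<gamma> e x = \<gamma> e y; x \<in> {0..1}; y \<in> {0..1}\<rbrakk> \<Longrightarrow> x = y"
  using arc_edge arcD by blast

text \<open>Disjoint edges can meet only once, and at a crossing. Distinct edges with a common end
  have just one common end, because two ends determine an edge, and they meet only there.\<close>

lemma edge_inter:
  assumes "e \<in> E" "f \<in> E" "e \<noteq> f"
  shows "\<exists>p. path_image (\<gamma> e) \<inter> path_image (\<gamma> f) \<subseteq> {p}"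
    and "path_image (\<gamma> e) \<inter> path_image (\<gamma> f) \<subseteq> points"
proof -
  have "(\<exists>p. path_image (\<gamma> e) \<inter> path_image (\<gamma> f) \<subseteq> {p}) \<and>
      path_image (\<gamma> e) \<inter> path_image (\<gamma> f) \<subseteq> points"
  proof (cases "e \<inter> f = {}")
    case True
    have "path_image (\<gamma> e) \<inter> path_image (\<gamma> f) \<subseteq> points"
      using assms True by (auto simp: points_def crossing_points_def)
    moreover have "\<exists>p. path_image (\<gamma> e) \<inter> path_image (\<gamma> f) \<subseteq> {p}"
      using disjoint_edges_once[OF assms(1,2) True] by (metis singletonI subsetI)
    ultimately show ?thesis by blast
  next
    case False
    then obtain v where v: "v \<in> e" "v \<in> f" by blast
    have "e \<inter> f = {v}"
    proof (rule ccontr)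
      assume "e \<inter> f \<noteq> {v}"
      then obtain w where "w \<in> e" "w \<in> f" "w \<noteq> v" using v by blast
      then have "{v, w} = e" "{v, w} = f"
        using v edge[OF assms(1)] edge[OF assms(2)] by (auto simp: card_2_iff)
      then show False using assms(3) by simp
    qed
    then have "path_image (\<gamma> e) \<inter> path_image (\<gamma> f) = {pos v}"
      using adjacent_edges[OF assms False] by simp
    moreover have "v \<in> V" using v edge[OF assms(1)] by blast
    ultimately show ?thesis by (auto simp: points_def)
  qed
  then show "\<exists>p. path_image (\<gamma> e) \<inter> path_image (\<gamma> f) \<subseteq> {p}"
    "path_image (\<gamma> e) \<inter> path_image (\<gamma> f) \<subseteq> points" by blast+
qed

lemma segment_subset: "(e, t) \<in> segments \<Longrightarrow> path_image (segment (e, t)) \<subseteq> path_image (\<gamma> e)"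
  using segmentD[of e t] unfolding path_image_segment by (auto simp: path_image_def)

text \<open>The earlier piece ends no later than the parameter \<open>u\<close>, and the edge is
  injective.\<close>

lemma segments_of_one_edge:
  assumes et: "(e, t) \<in> segments" and eu: "(e, u) \<in> segments" and "t < u"
  shows "path_image (segment (e, t)) \<inter> path_image (segment (e, u)) \<subseteq> {\<gamma> e u}"
proof
  let ?n = "next_in (params e)"
  fix p assume "p \<in> path_image (segment (e, t)) \<inter> path_image (segment (e, u))"
  then obtain x y where xy: "p = \<gamma> e x" "p = \<gamma> e y" "x \<in> {t..?n t}" "y \<in> {u..?n u}"
    unfolding path_image_segment[OF et] path_image_segment[OF eu] by blast
  note t = segmentD[OF et] and u = segmentD[OF eu]
  have "x = y"
    using edge_eqD[OF t(1), of x y] xy t u by auto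
  moreover have "?n t \<le> u"
    using t(7) u(2) assms(3) by blast
  ultimately have "x = u"
    using xy by auto
  then show "p \<in> {\<gamma> e u}" using xy by simp
qed

lemma segment_inter:
  assumes "i \<in> segments" "j \<in> segments" "i \<noteq> j"
  shows "\<exists>p. path_image (segment i) \<inter> path_image (segment j) \<subseteq> {p}"
    and "path_image (segment i) \<inter> path_image (segment j) \<subseteq> points"
proof -
  obtain e t f u where ij: "i = (e, t)" "j = (f, u)" by (metis surj_pair)
  note s = assms[unfolded ij]
  have "(\<exists>p. path_image (segment i) \<inter> path_image (segment j) \<subseteq> {p}) \<and>
      path_image (segment i) \<inter> path_image (segment j) \<subseteq> points"
  proof (cases "e = f")
    case False
    then show ?thesis
      using edge_inter[of e f] segment_subset[OF s(1)] segment_subset[OF s(2)]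
        segmentD(1)[OF s(1)] segmentD(1)[OF s(2)] unfolding ij by blast
  next
    case True
    have "\<gamma> e t \<in> points" "\<gamma> e u \<in> points"
      using segmentD(2)[OF s(1)] segmentD(2)[OF s(2)] True by (auto simp: params_def)
    moreover have "t < u \<or> u < t"
      using s(3) True by auto
    ultimately show ?thesis
      using segments_of_one_edge[of e t u] segments_of_one_edge[of e u t] s True unfolding ij by blast
  qed
  then show "\<exists>p. path_image (segment i) \<inter> path_image (segment j) \<subseteq> {p}"
    "path_image (segment i) \<inter> path_image (segment j) \<subseteq> points" by blast+
qed

sublocale planar: plane_arcs points segments segment
proof
  show "finite points" by (rule finite_points)
  show "finite segments" unfolding segments_def using finite_E params by blast
  fix i assume i: "i \<in> segments"
  obtain e t where et: "i = (e, t)" by (metis surj_pair)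
  note s = segmentD[OF i[unfolded et]]
  let ?n = "next_in (params e) t"
  show "arc (segment i)"
    using arc_subpath_arc[OF arc_edge[OF s(1)], of t ?n] s by (simp add: et segment_def)
  have ends: "pathstart (segment i) = \<gamma> e t" "pathfinish (segment i) = \<gamma> e ?n"
    by (simp_all add: et segment_def)
  show "path_image (segment i) \<inter> points = {pathstart (segment i), pathfinish (segment i)}"
  proof
    show "path_image (segment i) \<inter> points \<subseteq> {pathstart (segment i), pathfinish (segment i)}"
    proof
      fix p assume p: "p \<in> path_image (segment i) \<inter> points"
      then obtain x where x: "x \<in> {t..?n}" "p = \<gamma> e x"
        using path_image_segment i et by auto
      \<comment> \<open>No element of \<open>params e\<close> lies strictly between \<open>t\<close>
        and its successor, so \<open>x\<close> must be one of the two.\<close>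
      then have "x \<in> params e"
        using p s by (auto simp: params_def)
      then have "x = t \<or> x = ?n"
        using s(7)[of x] x(1) by force
      then show "p \<in> {pathstart (segment i), pathfinish (segment i)}"
        using x ends by auto
    qed
    show "{pathstart (segment i), pathfinish (segment i)} \<subseteq> path_image (segment i) \<inter> points"
      using s(2,3) ends pathstart_in_path_image[of "segment i"] pathfinish_in_path_image[of "segment i"]
      by (auto simp: params_def)
  qed
  show "path_image (segment i) \<inter> path_image (segment j) \<subseteq> points" if "j \<in> segments" "i \<noteq> j" for j
    using segment_inter(2)[OF i] that by blast
qed

lemma edge_subset_support: "e \<in> E \<Longrightarrow> path_image (\<gamma> e) \<subseteq> planar.support segments"
proof
  fix p assume e: "e \<in> E" and "p \<in> path_image (\<gamma> e)"
  then obtain x where x: "x \<in> {0..1}" "p = \<gamma> e x"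
    by (auto simp: path_image_def)
  obtain t where t: "t \<in> params e - {1}" "x \<in> {t..next_in (params e) t}"
    by (rule next_in_cover[OF params(1-4)[OF e] x(1)])
  then have "(e, t) \<in> segments"
    using e by (simp add: segments_def)
  then show "p \<in> planar.support segments"
    using t x path_image_segment unfolding planar.support_def by blast
qed

text \<open>A triangle through \<open>e = {u, v}\<close> provides a detour: from one end of the
  segment along \<open>e\<close> to an end of \<open>e\<close>, through the third vertex
  \<open>w\<close> to the other end of \<open>e\<close>, and back along \<open>e\<close> to the
  other end of the segment.\<close>

lemma segment_not_bridge:
  assumes i: "i \<in> segments"
    and tri: "\<And>u v. {u, v} \<in> E \<Longrightarrow> \<exists>w. w \<noteq> u \<and> w \<noteq> v \<and> {u, w} \<in> E \<and> {v, w} \<in> E"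
  shows "path_component (planar.support (segments - {i})) (pathstart (segment i)) (pathfinish (segment i))"
proof -
  obtain e t where et: "i = (e, t)" by (metis surj_pair)
  note s = segmentD[OF i[unfolded et]]
  let ?n = "next_in (params e) t" and ?S = "planar.support (segments - {i})"
  have img: "path_image (segment i) = \<gamma> e ` {t..?n}"
    using path_image_segment i et by simp
  \<comment> \<open>Removing a segment deletes at most its interior, since \<open>points\<close>
    stays in the support.\<close>
  have rest: "p \<in> ?S" if "p \<in> planar.support segments" "p \<in> path_image (segment i) \<Longrightarrow> p \<in> points" for p
    using that by (auto simp: planar.support_def)
  have path: "path (\<gamma> e)"
    by (rule arc_imp_path) (rule arc_edge[OF s(1)])
  have piece: "path_component ?S (\<gamma> e a) (\<gamma> e b)"
    if ab: "0 \<le> a" "a \<le> b" "b \<le> 1" and out: "{a..b} \<inter> {t..?n} \<subseteq> {t, ?n}" for a b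
  proof (rule path_component_path_image)
    show "path (subpath a b (\<gamma> e))"
      using path ab by (intro path_subpath) auto
    have im: "path_image (subpath a b (\<gamma> e)) = \<gamma> e ` {a..b}"
      using ab by (simp add: path_image_subpath)
    show "path_image (subpath a b (\<gamma> e)) \<subseteq> ?S"
    proof
      fix p assume "p \<in> path_image (subpath a b (\<gamma> e))"
      then obtain x where x: "x \<in> {a..b}" "p = \<gamma> e x" using im by blast
      have "p \<in> path_image (\<gamma> e)"
        using x ab by (auto simp: path_image_def)
      moreover have "p \<in> points" if pi: "p \<in> path_image (segment i)"
      proof -
        obtain y where y: "y \<in> {t..?n}" "p = \<gamma> e y" using pi img by blast
        have "x = y"
        proof (rule edge_eqD[OF s(1)])
          show "\<gamma> e x = \<gamma> e y" using x(2) y(2) by simp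
          show "x \<in> {0..1}" "y \<in> {0..1}" using x(1) y(1) ab(1,3) s(5,6) by auto
        qed
        then have "x = t \<or> x = ?n"
          using out x(1) y(1) by auto
        then have "x \<in> params e"
          using s(2,3) by auto
        then show ?thesis using x by (simp add: params_def)
      qed
      ultimately show "p \<in> ?S"
        using rest edge_subset_support[OF s(1)] by blast
    qed
    show "\<gamma> e a \<in> path_image (subpath a b (\<gamma> e))" "\<gamma> e b \<in> path_image (subpath a b (\<gamma> e))"
      using im ab by auto
  qed
  have other: "path_component ?S (pos x) (pos y)" if "{x, y} \<in> E" "{x, y} \<noteq> e" for x y
  proof (rule path_component_path_image)
    show "path (\<gamma> {x, y})"
      by (rule arc_imp_path) (rule arc_edge[OF that(1)])
    show "path_image (\<gamma> {x, y}) \<subseteq> ?S"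
    proof
      fix p assume p: "p \<in> path_image (\<gamma> {x, y})"
      have "p \<in> points" if "p \<in> path_image (segment i)"
        using that p edge_inter(2)[OF s(1) \<open>{x, y} \<in> E\<close>] \<open>{x, y} \<noteq> e\<close>
          segment_subset[OF i[unfolded et]] et by blast
      then show "p \<in> ?S"
        using rest edge_subset_support[OF that(1)] p by blast
    qed
    show "pos x \<in> path_image (\<gamma> {x, y})" "pos y \<in> path_image (\<gamma> {x, y})"
      using ends_subset[OF that(1)] by auto
  qed
  obtain u v where uv: "e = {u, v}" "u \<noteq> v"
    using edge[OF s(1)] by (auto simp: card_2_iff)
  obtain w where w: "w \<noteq> u" "w \<noteq> v" "{u, w} \<in> E" "{v, w} \<in> E"
    using tri[of u v] s(1) uv by blast
  have "path_component ?S (pos u) (pos w)" "path_component ?S (pos v) (pos w)"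
    using w uv by (intro other; auto simp: doubleton_eq_iff)+
  then have uv_conn: "path_component ?S (pos u) (pos v)"
    by (blast intro: path_component_trans path_component_sym)
  have "{\<gamma> e 0, \<gamma> e 1} = {pos u, pos v}"
    using ends_edge[OF s(1)] uv by (simp add: pathstart_def pathfinish_def)
  \<comment> \<open>The direction of the arc is not prescribed, so both orders must be
    allowed.\<close>
  then have "\<gamma> e 0 = pos u \<and> \<gamma> e 1 = pos v \<or> \<gamma> e 0 = pos v \<and> \<gamma> e 1 = pos u"
    by (auto simp: doubleton_eq_iff)
  then have "path_component ?S (\<gamma> e 0) (\<gamma> e 1)"
    using uv_conn path_component_sym[OF uv_conn] by auto
  moreover have "path_component ?S (\<gamma> e 0) (\<gamma> e t)"
    using s(4-6) by (intro piece) auto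
  moreover have "path_component ?S (\<gamma> e ?n) (\<gamma> e 1)"
    using s(4-6) by (intro piece) auto
  ultimately have "path_component ?S (\<gamma> e t) (\<gamma> e ?n)"
    by (blast intro: path_component_trans path_component_sym)
  then show ?thesis
    by (simp add: et segment_def)
qed

theorem card_edges_le:
  assumes "3 \<le> card E"
    and "\<And>u v. {u, v} \<in> E \<Longrightarrow> \<exists>w. w \<noteq> u \<and> w \<noteq> v \<and> {u, w} \<in> E \<and> {v, w} \<in> E"
  shows "card E + 6 \<le> 3 * card V"
proof -
  have "card segments + 6 \<le> 3 * card points"
  proof (rule planar.card_arcs_le)
    show "3 \<le> card segments"
      using assms(1) card_segments by simp
    show "\<exists>p. path_image (segment i) \<inter> path_image (segment j) \<subseteq> {p}"
      if "i \<in> segments" "j \<in> segments" "i \<noteq> j" for i j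
      using segment_inter(1) that by blast
    show "path_component (planar.support (segments - {i})) (pathstart (segment i)) (pathfinish (segment i))"
      if "i \<in> segments" for i
      using segment_not_bridge[OF that] assms(2) by blast
  qed
  \<comment> \<open>The term \<open>3 * card crossings\<close> occurs on both sides and
    cancels.\<close>
  then show ?thesis
    using card_segments card_points by linarith
qed

end

subsection \<open>Complete multipartite graphs\<close>

lemma complete_multipartiteE:
  assumes "complete_multipartite t V E"
  obtains P where "finite V" "partition_on V P" "card P = t"
    "\<forall>u v. {u, v} \<in> E \<longleftrightarrow> u \<in> V \<and> v \<in> V \<and> \<not> (\<exists>X\<in>P. u \<in> X \<and> v \<in> X)"
    "\<forall>e\<in>E. \<exists>u v. u \<noteq> v \<and> e = {u, v} \<and> u \<in> V \<and> v \<in> V"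
proof -
  from assms obtain P where P: "finite V" "partition_on V P" "card P = t"
    and E: "E = {{u, v} | u v. u \<in> V \<and> v \<in> V \<and> \<not> (\<exists>X\<in>P. u \<in> X \<and> v \<in> X)}"
    unfolding complete_multipartite_def by blast
  have edge: "{u, v} \<in> E \<longleftrightarrow> u \<in> V \<and> v \<in> V \<and> \<not> (\<exists>X\<in>P. u \<in> X \<and> v \<in> X)" for u v
    unfolding E by (auto simp: doubleton_eq_iff)
  have "\<exists>u v. u \<noteq> v \<and> e = {u, v} \<and> u \<in> V \<and> v \<in> V" if e: "e \<in> E" for e
  proof -
    obtain u v where uv: "e = {u, v}" "u \<in> V" "v \<in> V" "\<not> (\<exists>X\<in>P. u \<in> X \<and> v \<in> X)"
      using e E by blast
    \<comment> \<open>A vertex shares a part with itself, so there are no loops.\<close>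
    then have "u \<noteq> v"
      using partition_onD1[OF P(2)] by blast
    then show ?thesis using uv by blast
  qed
  then show ?thesis
    by (intro that[OF P] allI ballI edge)
qed

text \<open>One element is chosen from each of \<open>n\<close> parts; disjointness of the parts
  keeps the choices distinct.\<close>

lemma partition_transversal:
  assumes "partition_on V P" "finite V" "n \<le> card P"
  obtains R where "R \<subseteq> V" "card R = n"
    "\<forall>X\<in>P. \<forall>u\<in>R \<inter> X. \<forall>v\<in>R \<inter> X. u = v"
proof -
  obtain Q where Q: "Q \<subseteq> P" "card Q = n"
    using obtain_subset_with_card_n[OF assms(3)] by blast
  define r where "r X = (SOME x. x \<in> X)" for X :: "'a set"
  have r: "r X \<in> X" if "X \<in> P" for X
    using partition_onD3[OF assms(1)] that unfolding r_def by (metis ex_in_conv someI_ex)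
  have uniq: "X = Y" if "X \<in> P" "Y \<in> P" "x \<in> X" "x \<in> Y" for X Y x
    using partition_onD2[OF assms(1)] that by (meson disjointD disjoint_iff)
  have "inj_on r Q"
    using r uniq Q(1) by (metis inj_onI subsetD)
  then have "card (r ` Q) = n"
    using Q(2) by (simp add: card_image)
  moreover have "r ` Q \<subseteq> V"
    using r Q(1) partition_onD1[OF assms(1)] by blast
  moreover have "u = v" if "X \<in> P" "u \<in> r ` Q \<inter> X" "v \<in> r ` Q \<inter> X" for X u v
    using that r uniq Q(1) by (metis IntD1 IntD2 imageE subsetD)
  ultimately show ?thesis using that by blast
qed

text \<open>Five vertices from different parts span 10 edges. Any other vertex has at most one of
  them in its own part, so it is adjacent to at least four. This gives
  \<open>card E \<ge> 10 + 4 * (card V - 5)\<close>, which suffices as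
  \<open>card V \<ge> 5\<close>.\<close>

lemma complete_multipartite_card_edges:
  assumes "complete_multipartite t V E" "5 \<le> t"
  shows "3 * card V < card E + 6"
proof -
  obtain P where P: "finite V" "partition_on V P" "card P = t"
    and edge: "\<forall>u v. {u, v} \<in> E \<longleftrightarrow> u \<in> V \<and> v \<in> V \<and> \<not> (\<exists>X\<in>P. u \<in> X \<and> v \<in> X)"
    and edges: "\<forall>e\<in>E. \<exists>u v. u \<noteq> v \<and> e = {u, v} \<and> u \<in> V \<and> v \<in> V"
    by (rule complete_multipartiteE[OF assms(1)])
  have "5 \<le> card P" using P(3) assms(2) by simp
  obtain R where R: "R \<subseteq> V" "card R = 5"
    and one: "\<forall>X\<in>P. \<forall>u\<in>R \<inter> X. \<forall>v\<in>R \<inter> X. u = v"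
    by (rule partition_transversal[OF P(2,1) \<open>5 \<le> card P\<close>])
  have finR: "finite R" using R(1) P(1) finite_subset by blast
  have "E \<subseteq> Pow V" using edges by fastforce
  then have finE: "finite E" using P(1) by (simp add: finite_subset)
  define A where "A = {e. e \<subseteq> R \<and> card e = 2}"
  define N where "N v = {r \<in> R. {v, r} \<in> E}" for v
  define B where "B = (\<lambda>(v, r). {v, r}) ` Sigma (V - R) N"
  have A: "A \<subseteq> E"
  proof
    fix e assume "e \<in> A"
    then obtain u v where "e = {u, v}" "u \<noteq> v" "u \<in> R" "v \<in> R"
      unfolding A_def by (auto simp: card_2_iff)
    then show "e \<in> E" using edge one R(1) by blast
  qed
  have cA: "card A = 10"
    using n_subsets[OF finR, of 2] R(2) by (simp add: A_def choose_two)
  have B: "B \<subseteq> E" by (auto simp: B_def N_def)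
  have "A \<inter> B = {}" by (auto simp: A_def B_def N_def)
  \<comment> \<open>Exactly one member of such a pair lies in \<open>R\<close>, so the unordered
    pair determines the ordered one.\<close>
  have inj: "inj_on (\<lambda>(v, r). {v, r}) (Sigma (V - R) N)"
    by (auto simp: inj_on_def N_def doubleton_eq_iff)
  have N: "4 \<le> card (N v)" if v: "v \<in> V - R" for v
  proof -
    obtain X where X: "X \<in> P" "v \<in> X"
      using v partition_onD1[OF P(2)] by blast
    have uniq: "Y = X" if "Y \<in> P" "v \<in> Y" for Y
      using partition_onD2[OF P(2)] that X by (meson disjointD disjoint_iff)
    have "R - X \<subseteq> N v"
      using v edge R(1) uniq unfolding N_def by blast
    moreover have "card (R \<inter> X) \<le> 1"
      using bspec[OF one X(1)] card_le_Suc0_iff_eq[of "R \<inter> X"] finR by simp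
    then have "4 \<le> card (R - X)"
      using card_Diff_subset_Int[of R X] finR R(2) by simp
    moreover have "finite (N v)" using finR by (simp add: N_def)
    ultimately show ?thesis by (meson card_mono le_trans)
  qed
  have "card B = (\<Sum>v\<in>V - R. card (N v))"
    unfolding B_def card_image[OF inj] using P(1) finR by (simp add: N_def)
  also have "\<dots> \<ge> (\<Sum>v\<in>V - R. 4)"
    by (rule sum_mono) (rule N)
  finally have cB: "4 * card (V - R) \<le> card B" by simp
  have "card A + card B = card (A \<union> B)"
    using A B finE \<open>A \<inter> B = {}\<close> by (metis card_Un_disjoint finite_subset)
  also have "\<dots> \<le> card E"
    using A B finE by (intro card_mono) auto
  finally have "10 + 4 * card (V - R) \<le> card E"
    using cA cB by simp
  moreover have "card V = 5 + card (V - R)"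
    using card_Diff_subset[OF finR R(1)] card_mono[OF P(1) R(1)] R(2) by simp
  ultimately show ?thesis by simp
qed

text \<open>Among three parts one contains neither end of the edge, and any of its vertices will do.
  These triangles rule out bridges in the planarization.\<close>

lemma complete_multipartite_common_neighbour:
  assumes "complete_multipartite t V E" "3 \<le> t" "{u, v} \<in> E"
  shows "\<exists>w. w \<noteq> u \<and> w \<noteq> v \<and> {u, w} \<in> E \<and> {v, w} \<in> E"
proof -
  obtain P where P: "finite V" "partition_on V P" "card P = t"
    and edge: "\<forall>u v. {u, v} \<in> E \<longleftrightarrow> u \<in> V \<and> v \<in> V \<and> \<not> (\<exists>X\<in>P. u \<in> X \<and> v \<in> X)"
    by (rule complete_multipartiteE[OF assms(1)])
  have uv: "u \<in> V" "v \<in> V" using edge assms(3) by blast+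
  then obtain X Y where X: "X \<in> P" "u \<in> X" and Y: "Y \<in> P" "v \<in> Y"
    using partition_onD1[OF P(2)] by blast
  have uniq: "A = B" if "A \<in> P" "B \<in> P" "x \<in> A" "x \<in> B" for A B x
    using partition_onD2[OF P(2)] that by (meson disjointD disjoint_iff)
  have "card {X, Y} < card P"
    using P(3) assms(2) card_insert_le_m1[of 2 "{Y}" X] by simp
  then obtain Z where Z: "Z \<in> P" "Z \<noteq> X" "Z \<noteq> Y"
    using X(1) Y(1) by (metis card_mono finite.emptyI finite.insertI insert_iff not_less subsetI)
  then obtain w where w: "w \<in> Z"
    using partition_onD3[OF P(2)] by (metis ex_in_conv)
  then have "w \<in> V" using Z(1) partition_onD1[OF P(2)] by blast
  moreover have "\<not> (\<exists>A\<in>P. u \<in> A \<and> w \<in> A)" "\<not> (\<exists>A\<in>P. v \<in> A \<and> w \<in> A)"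
    using uniq X Y Z w by metis+
  ultimately have "{u, w} \<in> E" "{v, w} \<in> E"
    using edge uv by blast+
  moreover have "w \<noteq> u" "w \<noteq> v"
    using uniq X Y Z w by metis+
  ultimately show ?thesis by blast
qed

theorem theorem3p1:
  fixes t :: nat and V :: "'a set" and E :: "'a set set"
  assumes "t \<ge> 5"
    and "complete_multipartite t V E"
  shows "(\<nexists>pos \<gamma>. semi_regular_drawing V E pos \<gamma>) \<and> tcr V E = \<infinity>"
proof -
  have none: "\<not> semi_regular_drawing V E pos \<gamma>" for pos \<gamma>
  proof
    assume "semi_regular_drawing V E pos \<gamma>"
    then have d: "drawing V E pos \<gamma>"
      and triple: "\<And>p. p \<in> crossing_points E \<gamma> \<Longrightarrow> card {e \<in> E. p \<in> path_image (\<gamma> e)} = 3"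
      by (auto simp: semi_regular_drawing_def)
    obtain P where P: "finite V" "partition_on V P" "card P = t"
      and edges: "\<forall>e\<in>E. \<exists>u v. u \<noteq> v \<and> e = {u, v} \<and> u \<in> V \<and> v \<in> V"
      by (rule complete_multipartiteE[OF assms(2)])
    interpret drawing V E pos \<gamma> by (rule d)
    interpret finite_drawing V E pos \<gamma>
    proof
      show "finite V" by (rule P(1))
      show "e \<subseteq> V \<and> card e = 2" if "e \<in> E" for e
        using bspec[OF edges that] by auto
    qed (rule triple)
    \<comment> \<open>One vertex from every part shows that there are at least five vertices, whence
      also enough edges for the upper bound to apply.\<close>
    obtain R where "R \<subseteq> V" "card R = t"
      by (rule partition_transversal[OF P(2,1) eq_imp_le[OF P(3)[symmetric]]])
    then have "5 \<le> card V"
      using assms(1) P(1) card_mono by (metis le_trans)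
    moreover have many: "3 * card V < card E + 6"
      by (rule complete_multipartite_card_edges[OF assms(2,1)])
    ultimately have "3 \<le> card E" by linarith
    moreover have "\<exists>w. w \<noteq> u \<and> w \<noteq> v \<and> {u, w} \<in> E \<and> {v, w} \<in> E" if "{u, v} \<in> E" for u v
      by (rule complete_multipartite_common_neighbour[OF assms(2) _ that]) (use assms(1) in simp)
    ultimately have "card E + 6 \<le> 3 * card V"
      by (rule card_edges_le)
    then show False using many by linarith
  qed
  \<comment> \<open>A drawing without crossings is vacuously semi-regular.\<close>
  moreover have "\<not> planar_graph V E"
    using none by (auto simp: planar_graph_def semi_regular_drawing_def)
  ultimately show ?thesis
    by (simp add: tcr_def)
qed

end
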